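(* Let $G$ be an $n$-vertex $s$-choosable graph with $n\ge 2$ and $\chi_{flex}(G)=m$. Let $l=\lceil n/\rho(G)\rceil$. Let $G_1$ and $G_2$ be vertex-disjoint graphs, each isomorphic to $G$, and let $H=G_1\vee G_2$. Then for every real number $r>2$, $$\chi_{flex}(H)\le \max\left\{\left\lceil l+\frac{\log_2(2n-l)}{1-h(1/r)}\right\rceil,\ \lceil r(s-1)+l\rceil,\ m\right\},$$ where $h(p)=-p\log_2 p-(1-p)\log_2(1-p)$ is the binary entropy function.
   Context: All graphs are finite, simple and nonempty. $G_1\vee G_2$ is the join: the disjoint union of $G_1$ and $G_2$ together with all edges between $V(G_1)$ and $V(G_2)$. $G$ is $s$-choosable if it has a proper $L$-coloring for every $s$-assignment $L$. A list assignment $L$ assigns to each vertex $v$ a set $L(v)$ of colors; it is a $k$-assignment if $|L(v)|=k$ for all $v$. A proper $L$-coloring is a function $f$ on the vertex set with $f(v)\in L(v)$ and $f(u)\neq f(v)$ for adjacent $u,v$. A request of $L$ is a function with non-empty domain $D$ of vertices assigning each $v\in D$ a color in $L(v)$. For $\epsilon\in(0,1]$, a graph with $L$ and request $q$ is $\epsilon$-satisfiable if some proper $L$-coloring $f$ has $f(v)=q(v)$ for at least $\epsilon|D|$ vertices $v\in D$; a graph is $(k,\epsilon)$-flexible if this holds for every $k$-assignment and every request. The Hall ratio is $\rho(G)=\max_{H'} |V(H')|/\alpha(H')$ over nonempty subgraphs $H'$ of $G$; the list flexibility number $\chi_{flex}(G)$ is the smallest $k$ such that $G$ is $(k,1/\rho(G))$-flexible.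 *)

theory Defs
  imports
    Complex_Main
    "Graph_Theory.Pair_Digraph"
    "Graph_Theory.Digraph_Component"
    "Graph_Theory.Digraph_Isomorphism"
begin

text \<open>
  A finite simple graph is a \<^locale>\<open>pair_graph\<close>: every edge is represented by
  its two orientations. Subgraphs and isomorphisms are the notions for digraphs,
  applied through \<^const>\<open>with_proj\<close>; subgraphs have to be required to be
  symmetric separately.
\<close>

definition simple_graph :: "'a pair_pre_digraph \<Rightarrow> bool" where
  "simple_graph G \<longleftrightarrow> pair_graph G \<and> pverts G \<noteq> {}"

definition graph_iso :: "'a pair_pre_digraph \<Rightarrow> 'b pair_pre_digraph \<Rightarrow> bool" where
  "graph_iso G H \<longleftrightarrow> digraph_iso (with_proj G) (with_proj H)"

text \<open>This is the join only for arguments with disjoint vertex sets.\<close>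

definition graph_join ::
    "'a pair_pre_digraph \<Rightarrow> 'a pair_pre_digraph \<Rightarrow> 'a pair_pre_digraph" where
  "graph_join G1 G2 =
     \<lparr> pverts = pverts G1 \<union> pverts G2,
       parcs = parcs G1 \<union> parcs G2 \<union> pverts G1 \<times> pverts G2 \<union> pverts G2 \<times> pverts G1 \<rparr>"

lemma simple_graph_join:
  assumes "simple_graph G1" "simple_graph G2" "pverts G1 \<inter> pverts G2 = {}"
  shows "simple_graph (graph_join G1 G2)"
proof -
  interpret G1: pair_graph G1 using assms by (simp add: simple_graph_def)
  interpret G2: pair_graph G2 using assms by (simp add: simple_graph_def)
  have "sym (parcs G1)" "sym (parcs G2)"
    using G1.pair_sym_arcs G2.pair_sym_arcs by (simp_all add: symmetric_def)
  then have "sym (parcs (graph_join G1 G2))"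
    unfolding graph_join_def sym_def by auto
  then have "pair_graph (graph_join G1 G2)"
    using assms(3) G1.wellformed' G2.wellformed' G1.no_loops' G2.no_loops'
      G1.pair_finite_verts G2.pair_finite_verts G1.pair_finite_arcs G2.pair_finite_arcs
    by unfold_locales (auto simp: graph_join_def symmetric_def)
  then show ?thesis
    using assms by (simp add: simple_graph_def graph_join_def)
qed

definition independent_set :: "'a pair_pre_digraph \<Rightarrow> 'a set \<Rightarrow> bool" where
  "independent_set G S \<longleftrightarrow> S \<subseteq> pverts G \<and> (\<forall>u\<in>S. \<forall>v\<in>S. (u, v) \<notin> parcs G)"

definition independence_number :: "'a pair_pre_digraph \<Rightarrow> nat" where
  "independence_number G = Max {card S | S. independent_set G S}"

definition hall_ratio :: "'a pair_pre_digraph \<Rightarrow> real" where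
  "hall_ratio G =
     Max {real (card (pverts H)) / real (independence_number H) | H.
            simple_graph H \<and> subgraph (with_proj H) (with_proj G)}"

definition k_assignment :: "'a pair_pre_digraph \<Rightarrow> nat \<Rightarrow> ('a \<Rightarrow> 'c set) \<Rightarrow> bool" where
  "k_assignment G k L \<longleftrightarrow> (\<forall>v\<in>pverts G. finite (L v) \<and> card (L v) = k)"

definition proper_list_coloring ::
    "'a pair_pre_digraph \<Rightarrow> ('a \<Rightarrow> 'c set) \<Rightarrow> ('a \<Rightarrow> 'c) \<Rightarrow> bool" where
  "proper_list_coloring G L f \<longleftrightarrow>
     (\<forall>v\<in>pverts G. f v \<in> L v) \<and> (\<forall>(u, v)\<in>parcs G. f u \<noteq> f v)"

text \<open>
  Colors are natural numbers in the notions below that quantify over all list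
  assignments. Since only finitely many colors occur in the lists of a finite graph,
  any other infinite set of colors gives the same notions.
\<close>

definition choosable :: "'a pair_pre_digraph \<Rightarrow> nat \<Rightarrow> bool" where
  "choosable G s \<longleftrightarrow>
     (\<forall>L :: 'a \<Rightarrow> nat set. k_assignment G s L \<longrightarrow> (\<exists>f. proper_list_coloring G L f))"

text \<open>A request is a partial function, whose domain is \<^term>\<open>dom q\<close>.\<close>

definition request ::
    "'a pair_pre_digraph \<Rightarrow> ('a \<Rightarrow> 'c set) \<Rightarrow> ('a \<rightharpoonup> 'c) \<Rightarrow> bool" where
  "request G L q \<longleftrightarrow>
     dom q \<noteq> {} \<and> dom q \<subseteq> pverts G \<and> (\<forall>v\<in>dom q. the (q v) \<in> L v)"

definition satisfiable ::
    "'a pair_pre_digraph \<Rightarrow> ('a \<Rightarrow> 'c set) \<Rightarrow> ('a \<rightharpoonup> 'c) \<Rightarrow> real \<Rightarrow> bool" where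
  "satisfiable G L q \<epsilon> \<longleftrightarrow>
     (\<exists>f. proper_list_coloring G L f \<and>
          real (card {v \<in> dom q. q v = Some (f v)}) \<ge> \<epsilon> * real (card (dom q)))"

definition flexible :: "'a pair_pre_digraph \<Rightarrow> nat \<Rightarrow> real \<Rightarrow> bool" where
  "flexible G k \<epsilon> \<longleftrightarrow>
     (\<forall>(L :: 'a \<Rightarrow> nat set) q. k_assignment G k L \<longrightarrow> request G L q \<longrightarrow> satisfiable G L q \<epsilon>)"

text \<open>
  List sizes have to be positive: empty lists admit no request, so every graph
  would be flexible for \<^term>\<open>k = (0::nat)\<close> vacuously. The minimum is attained: if
  \<^term>\<open>k\<close> exceeds the maximum degree, grant the request on an independent set
  containing at least the required fraction of its domain and color the remaining
  vertices greedily.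
\<close>

definition chi_flex :: "'a pair_pre_digraph \<Rightarrow> nat" where
  "chi_flex G = (LEAST k. k \<ge> 1 \<and> flexible G k (1 / hall_ratio G))"

definition binary_entropy :: "real \<Rightarrow> real" where
  "binary_entropy p = - p * log 2 p - (1 - p) * log 2 (1 - p)"

end

theory Submission
  imports Defs
begin

text \<open>
  By pigeonhole, one copy of \<open>G\<close>, say \<open>G\<^sub>1\<close>, receives at least half of the request, and
  \<open>\<rho>(H) \<ge> 2 \<rho>(G)\<close>, so it suffices to satisfy a fraction \<open>1 / \<rho>(G)\<close> of the part in \<open>G\<^sub>1\<close>.
  Take a flexible coloring of \<open>G\<^sub>1\<close>, keep it on a set \<open>S\<close> of exactly \<open>l\<close> vertices containing
  enough satisfied ones, and delete its colors on \<open>S\<close> from all other lists, which leaves at least \<open>N = k - l\<close>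
  colors at each of the \<open>2n - l\<close> uncolored vertices. Split the colors at random into one part for
  \<open>G\<^sub>1\<close> and one for \<open>G\<^sub>2\<close>. A vertex is left with fewer than \<open>s\<close> colors with probability
  \<open>2\<^sup>-\<^sup>N (\<Sum>i<s. N choose i) < 2 powr (- (1 - h (1/r)) N)\<close>, so by the union bound some split leaves
  \<open>s\<close> colors everywhere, and both copies are completed by \<open>s\<close>-choosability.
\<close>

section \<open>Binary entropy and binomial tails\<close>

text \<open>This is Gibbs' inequality against the fair coin: \<open>ln x < x - 1\<close> is applied
  at \<open>1 / (2 * p)\<close> and \<open>1 / (2 * (1 - p))\<close>, both different from 1 because
  \<open>p\<close> is not one half, and the weighted right-hand sides cancel.\<close>

lemma binary_entropy_less_one:
  assumes "0 < p" "p < 1 / 2"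
  shows "binary_entropy p < 1"
proof -
  have less: "ln x < x - 1" if "0 < x" "x \<noteq> 1" for x :: real
    using that ln_le_minus_one[of x] ln_eq_minus_one[of x] by linarith
  have "p * ln (1 / (2 * p)) < p * (1 / (2 * p) - 1)"
    using assms by (intro mult_strict_left_mono less) (auto simp: field_simps)
  moreover have "(1 - p) * ln (1 / (2 * (1 - p))) < (1 - p) * (1 / (2 * (1 - p)) - 1)"
    using assms by (intro mult_strict_left_mono less) (auto simp: field_simps)
  moreover have "p * (1 / (2 * p) - 1) + (1 - p) * (1 / (2 * (1 - p)) - 1) = 0"
    using assms by (simp add: field_simps)
  ultimately have neg: "p * ln (1 / (2 * p)) + (1 - p) * ln (1 / (2 * (1 - p))) < 0"
    by linarith
  have eqs: "ln (1 / (2 * p)) = - ln 2 - ln p" "ln (1 / (2 * (1 - p))) = - ln 2 - ln (1 - p)"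
    using assms ln_mult[of 2 "1 - p"] by (simp_all add: ln_div ln_mult)
  have "- p * ln p - (1 - p) * ln (1 - p) < ln 2"
    using neg unfolding eqs by (simp add: algebra_simps)
  then have "(- p * ln p - (1 - p) * ln (1 - p)) / ln 2 < 1"
    by simp
  then show ?thesis
    by (simp add: binary_entropy_def log_def diff_divide_distrib)
qed

text \<open>
  Strictness comes from the term \<^term>\<open>p ^ N\<close> of the binomial expansion of
  \<^term>\<open>(p + (1 - p)) ^ N\<close>, which lies outside the tail.
\<close>

lemma sum_binomial_less_entropy:
  assumes "0 < p" "p < 1 / 2" "0 < N" "real s - 1 \<le> p * real N"
  shows "(\<Sum>i<s. real (N choose i)) < 2 powr (binary_entropy p * real N)"
proof -
  \<comment> \<open>The constant \<open>c\<close> is the value of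
    \<open>p ^ i * (1 - p) ^ (N - i)\<close> at the real exponent \<open>i = p * N\<close>. That
    expression decreases in \<open>i\<close> because \<open>p < 1 - p\<close>, and every
    \<open>i < s\<close> is at most \<open>s - 1 \<le> p * N\<close>.\<close>
  define c where "c = 2 powr (- binary_entropy p * real N)"
  have c: "c = exp (p * N * ln p + (1 - p) * N * ln (1 - p))"
    by (simp add: c_def powr_def binary_entropy_def log_def field_simps)
  have "p * real N < real N"
    using assms by simp
  then have "s \<le> N"
    using assms(4) by linarith
  have term_ge: "c \<le> p ^ i * (1 - p) ^ (N - i)" if "i < s" for i
  proof -
    have "0 \<le> (p * N - real i) * (ln (1 - p) - ln p)"
      using assms that by (intro mult_nonneg_nonneg) auto
    then have "p * N * ln p + (1 - p) * N * ln (1 - p) \<le> real i * ln p + real (N - i) * ln (1 - p)"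
      using that \<open>s \<le> N\<close> by (simp add: of_nat_diff algebra_simps)
    then have "c \<le> exp (real i * ln p + real (N - i) * ln (1 - p))"
      by (simp add: c)
    also have "\<dots> = p ^ i * (1 - p) ^ (N - i)"
      using assms by (simp add: exp_add exp_of_nat_mult)
    finally show ?thesis .
  qed
  have "c * (\<Sum>i<s. real (N choose i)) = (\<Sum>i<s. real (N choose i) * c)"
    by (simp add: sum_distrib_left mult.commute)
  also have "\<dots> \<le> (\<Sum>i<s. real (N choose i) * p ^ i * (1 - p) ^ (N - i))"
    using term_ge by (intro sum_mono) (simp add: mult_left_mono mult.assoc)
  also have "\<dots> < (\<Sum>i\<le>N. real (N choose i) * p ^ i * (1 - p) ^ (N - i))"
    using assms \<open>s \<le> N\<close> by (intro sum_strict_mono2[where b = N]) auto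
  also have "\<dots> = (p + (1 - p)) ^ N"
    by (subst binomial_ring) simp
  finally have "c * (\<Sum>i<s. real (N choose i)) < 1"
    by simp
  then show ?thesis
    by (simp add: c_def powr_minus field_simps)
qed

text \<open>Here \<open>c\<close> is meant to be the number of uncolored vertices and
  \<open>N\<close> the number of colors left to each. The exponent \<open>N\<close> is shared out:
  \<open>(1 - h) * N\<close> pays for the factor \<open>c\<close>, and \<open>h * N\<close> pays for
  the binomial tail with \<open>p = 1 / r\<close>.\<close>

lemma union_bound_entropy:
  assumes "2 < r" "1 < c" "log 2 c / (1 - binary_entropy (1 / r)) \<le> real N"
    and "r * (real s - 1) \<le> real N"
  shows "c * (\<Sum>i<s. real (N choose i)) < 2 ^ N"
proof -
  let ?h = "binary_entropy (1 / r)"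
  have p: "0 < 1 / r" "1 / r < 1 / 2"
    using assms(1) by (auto simp: field_simps)
  have h: "?h < 1"
    using binary_entropy_less_one[OF p] .
  have "0 < log 2 c / (1 - ?h)"
    using assms(2) h by simp
  then have "0 < N"
    using assms(3) by linarith
  have "log 2 c \<le> (1 - ?h) * real N"
    using assms(3) h by (simp add: field_simps)
  then have "c \<le> 2 powr ((1 - ?h) * real N)"
    using assms(2) by (simp add: log_le_iff)
  moreover have "(\<Sum>i<s. real (N choose i)) < 2 powr (?h * real N)"
    using assms(1,4) p \<open>0 < N\<close> by (intro sum_binomial_less_entropy) (auto simp: field_simps)
  ultimately have "c * (\<Sum>i<s. real (N choose i))
      < 2 powr ((1 - ?h) * real N) * 2 powr (?h * real N)"
    using assms(2) by (intro mult_le_less_imp_less sum_nonneg) auto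
  also have "\<dots> = 2 ^ N"
    by (simp add: powr_add[symmetric] algebra_simps powr_realpow)
  finally show ?thesis .
qed

section \<open>Splitting the colors\<close>

lemma card_subsets_small:
  assumes "finite M"
  shows "card {X \<in> Pow M. card X < s} = (\<Sum>i<s. card M choose i)"
proof -
  have "{X \<in> Pow M. card X < s} = (\<Union>i<s. {X. X \<subseteq> M \<and> card X = i})"
    by auto
  also have "card \<dots> = (\<Sum>i<s. card {X. X \<subseteq> M \<and> card X = i})"
    using assms by (intro card_UN_disjoint) auto
  finally show ?thesis
    using assms by (simp add: n_subsets)
qed

text \<open>A subset \<open>A\<close> of \<open>C\<close> amounts to two independent choices,
  \<open>A - M\<close> and \<open>M \<inter> A\<close>, and only the second is constrained.\<close>

lemma card_subsets_small_inter:
  assumes "finite C" "M \<subseteq> C"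
  shows "card {A \<in> Pow C. card (M \<inter> A) < s}
    = 2 ^ (card C - card M) * (\<Sum>i<s. card M choose i)"
proof -
  have "bij_betw (\<lambda>A. (A - M, M \<inter> A)) {A \<in> Pow C. card (M \<inter> A) < s}
      (Pow (C - M) \<times> {X \<in> Pow M. card X < s})"
  proof (rule bij_betw_byWitness[where f' = "\<lambda>(X, Y). X \<union> Y"])
    have "M \<inter> (X \<union> Y) = Y" if "X \<subseteq> C - M" "Y \<subseteq> M" for X Y
      using that by blast
    then show "(\<lambda>(X, Y). X \<union> Y) ` (Pow (C - M) \<times> {X \<in> Pow M. card X < s})
        \<subseteq> {A \<in> Pow C. card (M \<inter> A) < s}"
      using assms by auto
  qed (use assms in auto)
  then have "card {A \<in> Pow C. card (M \<inter> A) < s}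
      = card (Pow (C - M) \<times> {X \<in> Pow M. card X < s})"
    by (rule bij_betw_same_card)
  then show ?thesis
    using assms finite_subset[OF assms(2,1)]
    by (simp only: card_cartesian_product card_subsets_small card_Pow card_Diff_subset finite_Diff)
qed

text \<open>Complementation in \<open>C\<close> exchanges the two sides of a split, so the count is
  the same for both copies.\<close>

lemma card_subsets_small_diff:
  assumes "finite C" "M \<subseteq> C"
  shows "card {A \<in> Pow C. card (M - A) < s}
    = 2 ^ (card C - card M) * (\<Sum>i<s. card M choose i)"
proof -
  have eq: "M \<inter> (C - A) = M - A" "M - (C - A) = M \<inter> A" for A
    using assms by auto
  have "bij_betw (\<lambda>A. C - A) {A \<in> Pow C. card (M - A) < s} {A \<in> Pow C. card (M \<inter> A) < s}"
    by (rule bij_betw_byWitness[where f' = "\<lambda>A. C - A"]) (auto simp: eq)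
  then show ?thesis
    using card_subsets_small_inter[OF assms] by (simp add: bij_betw_same_card)
qed

text \<open>
  The probabilistic method: among all subsets \<^term>\<open>A\<close> of the set of colors, the
  union bound leaves one that is bad for no vertex.
\<close>

lemma exists_color_split:
  assumes "finite V" "finite W"
    and M: "\<And>v. v \<in> V \<union> W \<Longrightarrow> finite (M v) \<and> card (M v) = N"
    and bound: "(card V + card W) * (\<Sum>i<s. N choose i) < 2 ^ N"
  obtains A where "\<And>v. v \<in> V \<Longrightarrow> s \<le> card (M v \<inter> A)" "\<And>v. v \<in> W \<Longrightarrow> s \<le> card (M v - A)"
\<comment> \<open>Without vertices the set \<open>C\<close> of all colors would be empty and
  \<open>N \<le> card C\<close> could fail; the union bound below relies on that inequality.\<close>
proof (cases "V \<union> W = {}")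
  case True
  then show ?thesis
    using that by auto
next
  case False
  define C where "C = (\<Union>v\<in>V \<union> W. M v)"
  define T where "T = (\<Sum>i<s. N choose i)"
  define B1 where "B1 v = {A \<in> Pow C. card (M v \<inter> A) < s}" for v
  define B2 where "B2 v = {A \<in> Pow C. card (M v - A) < s}" for v
  have fin: "finite C"
    using assms by (auto simp: C_def)
  have sub: "M v \<subseteq> C" if "v \<in> V \<union> W" for v
    using that by (auto simp: C_def)
  have B1: "card (B1 v) = 2 ^ (card C - N) * T" if "v \<in> V" for v
    using card_subsets_small_inter[OF fin sub, of v s] M[of v] that by (simp add: B1_def T_def)
  have B2: "card (B2 v) = 2 ^ (card C - N) * T" if "v \<in> W" for v
    using card_subsets_small_diff[OF fin sub, of v s] M[of v] that by (simp add: B2_def T_def)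
  obtain v where "v \<in> V \<union> W"
    using False by blast
  then have "N \<le> card C"
    using card_mono[OF fin sub] M by metis
  have "card ((\<Union>v\<in>V. B1 v) \<union> (\<Union>v\<in>W. B2 v)) \<le> (\<Sum>v\<in>V. card (B1 v)) + (\<Sum>v\<in>W. card (B2 v))"
    using card_UN_le[OF assms(1), of B1] card_UN_le[OF assms(2), of B2]
    by (intro order.trans[OF card_Un_le] add_mono)
  also have "\<dots> = (card V + card W) * T * 2 ^ (card C - N)"
    by (simp add: B1 B2 algebra_simps)
  also have "\<dots> < 2 ^ N * 2 ^ (card C - N)"
    using bound by (intro mult_strict_right_mono) (auto simp: T_def)
  also have "\<dots> = card (Pow C)"
    using \<open>N \<le> card C\<close> fin by (simp add: card_Pow power_add[symmetric])
  finally have "card ((\<Union>v\<in>V. B1 v) \<union> (\<Union>v\<in>W. B2 v)) < card (Pow C)" .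
  moreover have "finite ((\<Union>v\<in>V. B1 v) \<union> (\<Union>v\<in>W. B2 v))"
    using assms fin by (auto simp: B1_def B2_def)
  ultimately have "\<not> Pow C \<subseteq> (\<Union>v\<in>V. B1 v) \<union> (\<Union>v\<in>W. B2 v)"
    by (meson card_mono leD)
  then obtain A where "A \<in> Pow C" "A \<notin> (\<Union>v\<in>V. B1 v) \<union> (\<Union>v\<in>W. B2 v)"
    by blast
  then show ?thesis
    using that by (auto simp: B1_def B2_def not_less)
qed

section \<open>Independence number and Hall ratio\<close>

lemma independent_set_card_le:
  assumes "simple_graph G" "independent_set G S"
  shows "card S \<le> card (pverts G)"
proof -
  interpret pair_graph G
    using assms by (simp add: simple_graph_def)
  show ?thesis
    using assms pair_finite_verts by (auto simp: independent_set_def intro: card_mono)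
qed

lemma finite_independent_cards:
  assumes "simple_graph G"
  shows "finite {card S | S. independent_set G S}"
  by (rule finite_subset[of _ "{..card (pverts G)}"])
    (auto dest: independent_set_card_le[OF assms])

lemma card_le_independence_number:
  assumes "simple_graph G" "independent_set G S"
  shows "card S \<le> independence_number G"
  unfolding independence_number_def
  using assms by (intro Max_ge finite_independent_cards) auto

lemma independence_number_attained:
  assumes "simple_graph G"
  obtains S where "independent_set G S" "card S = independence_number G"
proof -
  have "independent_set G {}"
    by (simp add: independent_set_def)
  then have "independence_number G \<in> {card S | S. independent_set G S}"
    unfolding independence_number_def
    using assms by (intro Max_in finite_independent_cards) auto
  then show ?thesis
    using that by auto
qed

lemma independence_number_le_card:
  "simple_graph G \<Longrightarrow> independence_number G \<le> card (pverts G)"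
  by (metis independence_number_attained independent_set_card_le)

lemma independence_number_pos:
  assumes "simple_graph G"
  shows "0 < independence_number G"
proof -
  interpret pair_graph G
    using assms by (simp add: simple_graph_def)
  obtain v where "v \<in> pverts G"
    using assms by (auto simp: simple_graph_def)
  then have "independent_set G {v}"
    using no_loops' by (auto simp: independent_set_def)
  then show ?thesis
    using card_le_independence_number[OF assms] by fastforce
qed

lemma subgraph_with_proj_iff:
  "subgraph (with_proj A) (with_proj G) \<longleftrightarrow>
    pverts A \<subseteq> pverts G \<and> parcs A \<subseteq> parcs G \<and> pair_wf_digraph G \<and> pair_wf_digraph A"
  by (simp add: subgraph_def compatible_def wf_digraph_wp_iff)

lemma simple_graph_wf: "simple_graph G \<Longrightarrow> pair_wf_digraph G"
  by (simp add: simple_graph_def pair_graph_def pair_digraph_def pair_fin_digraph_def)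

text \<open>Each ratio is determined by two natural numbers bounded by the order of
  \<open>G\<close>. Finiteness is what gives the \<open>Max\<close> in \<open>hall_ratio\<close> its
  meaning.\<close>

lemma finite_hall_ratios:
  assumes "simple_graph G"
  shows "finite {real (card (pverts A)) / real (independence_number A) | A.
    simple_graph A \<and> subgraph (with_proj A) (with_proj G)}"
proof (rule finite_subset)
  interpret pair_graph G
    using assms by (simp add: simple_graph_def)
  let ?N = "{..card (pverts G)}"
  show "{real (card (pverts A)) / real (independence_number A) | A.
      simple_graph A \<and> subgraph (with_proj A) (with_proj G)}
    \<subseteq> (\<lambda>(a, b). real a / real b) ` (?N \<times> ?N)"
  proof safe
    fix A
    assume A: "simple_graph A" "subgraph (with_proj A) (with_proj G)"
    then have "card (pverts A) \<le> card (pverts G)"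
      using pair_finite_verts by (auto simp: subgraph_with_proj_iff intro: card_mono)
    then show "real (card (pverts A)) / real (independence_number A)
        \<in> (\<lambda>(a, b). real a / real b) ` (?N \<times> ?N)"
      using independence_number_le_card[OF A(1)]
      by (intro image_eqI[where x = "(card (pverts A), independence_number A)"]) auto
  qed
qed auto

lemma hall_ratio_ge:
  assumes "simple_graph G" "simple_graph A" "subgraph (with_proj A) (with_proj G)"
  shows "real (card (pverts A)) / real (independence_number A) \<le> hall_ratio G"
  unfolding hall_ratio_def
  using assms by (intro Max_ge finite_hall_ratios) auto

lemma hall_ratio_attained:
  assumes "simple_graph G"
  obtains A where "simple_graph A" "subgraph (with_proj A) (with_proj G)"
    "hall_ratio G = real (card (pverts A)) / real (independence_number A)"
proof -
  have "subgraph (with_proj G) (with_proj G)"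
    using simple_graph_wf[OF assms] by (simp add: subgraph_with_proj_iff)
  then have "hall_ratio G \<in> {real (card (pverts A)) / real (independence_number A) | A.
      simple_graph A \<and> subgraph (with_proj A) (with_proj G)}"
    unfolding hall_ratio_def
    using assms by (intro Max_in finite_hall_ratios) auto
  then show ?thesis
    using that by blast
qed

lemma hall_ratio_ge_one:
  assumes "simple_graph G"
  shows "1 \<le> hall_ratio G"
proof -
  have "subgraph (with_proj G) (with_proj G)"
    using simple_graph_wf[OF assms] by (simp add: subgraph_with_proj_iff)
  then have "real (card (pverts G)) / real (independence_number G) \<le> hall_ratio G"
    using hall_ratio_ge assms by blast
  moreover have "1 \<le> real (card (pverts G)) / real (independence_number G)"
    using independence_number_pos[OF assms] independence_number_le_card[OF assms]
    by (simp add: field_simps)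
  ultimately show ?thesis
    by linarith
qed

text \<open>A set meeting both sides would contain both ends of one of the added edges.\<close>

lemma independent_set_join:
  assumes "independent_set (graph_join G1 G2) S"
  shows "independent_set G1 S \<or> independent_set G2 S"
proof -
  have "S \<subseteq> pverts G1 \<or> S \<subseteq> pverts G2"
    using assms unfolding independent_set_def graph_join_def by simp blast
  then show ?thesis
    using assms by (auto simp: independent_set_def graph_join_def)
qed

section \<open>Isomorphic copies\<close>

definition image_graph :: "('a \<Rightarrow> 'b) \<Rightarrow> 'a pair_pre_digraph \<Rightarrow> 'b pair_pre_digraph" where
  "image_graph \<phi> G = \<lparr> pverts = \<phi> ` pverts G, parcs = map_prod \<phi> \<phi> ` parcs G \<rparr>"

lemma image_graph_simps [simp]:
  "pverts (image_graph \<phi> G) = \<phi> ` pverts G"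
  "parcs (image_graph \<phi> G) = map_prod \<phi> \<phi> ` parcs G"
  by (simp_all add: image_graph_def)

text \<open>Arcs are pairs of vertices on both sides, with \<open>fst\<close> and \<open>snd\<close>
  as tail and head. Hence the arc map of an isomorphism is forced by its vertex map, and a copy of
  \<open>G\<close> is just an injective renaming of vertices.\<close>

lemma graph_isoE:
  assumes "graph_iso G G'"
  obtains \<phi> where "inj_on \<phi> (pverts G)" "G' = image_graph \<phi> G"
proof -
  obtain f where f: "pre_digraph.digraph_isomorphism (with_proj G) f"
    and app: "with_proj G' = app_iso f (with_proj G)"
    using assms by (auto simp: graph_iso_def digraph_iso_def)
  let ?\<phi> = "iso_verts f"
  have ends: "iso_tail f = fst" "iso_head f = snd"
    using arg_cong[OF app, of tail] arg_cong[OF app, of head] by simp_all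
  have "iso_arcs f a = map_prod ?\<phi> ?\<phi> a" if "a \<in> parcs G" for a
    using f that by (auto simp: pre_digraph.digraph_isomorphism_def ends prod_eq_iff)
  then have "iso_arcs f ` parcs G = map_prod ?\<phi> ?\<phi> ` parcs G"
    by (simp cong: image_cong)
  moreover have "pverts G' = ?\<phi> ` pverts G" "parcs G' = iso_arcs f ` parcs G"
    using arg_cong[OF app, of verts] arg_cong[OF app, of arcs] by simp_all
  ultimately have "G' = image_graph ?\<phi> G"
    by simp
  moreover have "inj_on ?\<phi> (pverts G)"
    using f by (simp add: pre_digraph.digraph_isomorphism_def)
  ultimately show ?thesis
    using that by blast
qed

lemma simple_graph_image:
  assumes "simple_graph G" "inj_on \<phi> (pverts G)"
  shows "simple_graph (image_graph \<phi> G)"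
proof -
  interpret pair_graph G
    using assms by (simp add: simple_graph_def)
  have "\<phi> u \<noteq> \<phi> v" if "(u, v) \<in> parcs G" for u v
    using that assms(2) wellformed' no_loops' by (metis inj_onD)
  moreover have "sym (map_prod \<phi> \<phi> ` parcs G)"
    using arcs_symmetric by (force simp: sym_def)
  ultimately have "pair_graph (image_graph \<phi> G)"
    using pair_finite_verts pair_finite_arcs wellformed'
    by unfold_locales (auto simp: symmetric_def)
  then show ?thesis
    using assms by (simp add: simple_graph_def)
qed

text \<open>Independent sets of the copy pull back along \<open>\<phi>\<close>. The upper bound is
  the direction that serves to bound the Hall ratio of the join from below.\<close>

lemma independence_number_image_le:
  assumes "simple_graph G" "inj_on \<phi> (pverts G)"
  shows "independence_number (image_graph \<phi> G) \<le> independence_number G"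
proof -
  obtain S where S: "independent_set (image_graph \<phi> G) S"
    "card S = independence_number (image_graph \<phi> G)"
    using independence_number_attained simple_graph_image[OF assms] by blast
  then obtain T where T: "T \<subseteq> pverts G" "S = \<phi> ` T"
    by (auto simp: independent_set_def subset_image_iff)
  have "independent_set G T"
    using S(1) T by (force simp: independent_set_def)
  then show ?thesis
    using card_le_independence_number[OF assms(1)] S(2) T card_image inj_on_subset[OF assms(2)]
    by metis
qed

lemma k_assignment_comp:
  "k_assignment (image_graph \<phi> G) k L \<Longrightarrow> k_assignment G k (L \<circ> \<phi>)"
  by (auto simp: k_assignment_def)

lemma proper_list_coloring_image:
  assumes "simple_graph G" "inj_on \<phi> (pverts G)" "proper_list_coloring G (L \<circ> \<phi>) f"
  shows "proper_list_coloring (image_graph \<phi> G) L (f \<circ> inv_into (pverts G) \<phi>)"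
proof -
  interpret pair_graph G
    using assms by (simp add: simple_graph_def)
  show ?thesis
    using assms(2,3) wellformed' by (fastforce simp: proper_list_coloring_def)
qed

lemma choosable_image:
  assumes "simple_graph G" "inj_on \<phi> (pverts G)" "choosable G s"
  shows "choosable (image_graph \<phi> G) s"
  using assms k_assignment_comp proper_list_coloring_image unfolding choosable_def by blast

lemma flexible_image:
  assumes "simple_graph G" "inj_on \<phi> (pverts G)" "flexible G k \<epsilon>"
  shows "flexible (image_graph \<phi> G) k \<epsilon>"
  unfolding flexible_def
proof (intro allI impI)
  fix L :: "'b \<Rightarrow> nat set" and q
  assume L: "k_assignment (image_graph \<phi> G) k L" and q: "request (image_graph \<phi> G) L q"
  \<comment> \<open>The restriction to \<open>pverts G\<close> matters: elsewhere
    \<open>\<phi>\<close> is arbitrary and may also hit \<open>dom q\<close>.\<close>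
  define p where "p v = (if v \<in> pverts G then q (\<phi> v) else None)" for v
  have dom_p: "dom p = {v \<in> pverts G. \<phi> v \<in> dom q}"
    by (auto simp: p_def split: if_splits)
  have dom_q: "dom q \<subseteq> \<phi> ` pverts G"
    using q by (simp add: request_def)
  then have img: "\<phi> ` dom p = dom q"
    unfolding dom_p by blast
  have inj: "inj_on \<phi> (dom p)"
    using assms(2) by (rule inj_on_subset) (auto simp: dom_p)
  have "request G (L \<circ> \<phi>) p"
    unfolding request_def
  proof (intro conjI ballI)
    show "dom p \<noteq> {}"
      using q unfolding request_def img[symmetric] by blast
    show "dom p \<subseteq> pverts G"
      by (auto simp: dom_p)
    fix v
    assume "v \<in> dom p"
    then have v: "v \<in> pverts G" "\<phi> v \<in> dom q"
      unfolding dom_p by blast+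
    then have "the (q (\<phi> v)) \<in> L (\<phi> v)"
      using q unfolding request_def by blast
    then show "the (p v) \<in> (L \<circ> \<phi>) v"
      using v(1) by (simp add: p_def)
  qed
  then obtain f where f: "proper_list_coloring G (L \<circ> \<phi>) f"
    and sat: "\<epsilon> * card (dom p) \<le> card {v \<in> dom p. p v = Some (f v)}"
    using assms(3) k_assignment_comp[OF L] by (auto simp: flexible_def satisfiable_def)
  let ?g = "f \<circ> inv_into (pverts G) \<phi>"
  have "{w \<in> dom q. q w = Some (?g w)} = \<phi> ` {v \<in> dom p. p v = Some (f v)}"
    using assms(2) unfolding img[symmetric] by (auto simp: dom_p p_def)
  then have "card {w \<in> dom q. q w = Some (?g w)} = card {v \<in> dom p. p v = Some (f v)}"
    using inj by (simp add: card_image inj_on_subset)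
  moreover have "card (dom q) = card (dom p)"
    using img inj card_image by metis
  ultimately show "satisfiable (image_graph \<phi> G) L q \<epsilon>"
    using proper_list_coloring_image[OF assms(1,2) f] sat unfolding satisfiable_def by metis
qed

text \<open>
  The two copies of a subgraph attaining the Hall ratio span twice as many vertices in
  the join, while an independent set still lies in one of the copies.
\<close>

lemma hall_ratio_join_ge:
  assumes "simple_graph G" "inj_on \<phi> (pverts G)" "inj_on \<psi> (pverts G)"
    and "\<phi> ` pverts G \<inter> \<psi> ` pverts G = {}"
  shows "2 * hall_ratio G \<le> hall_ratio (graph_join (image_graph \<phi> G) (image_graph \<psi> G))"
proof -
  let ?H = "graph_join (image_graph \<phi> G) (image_graph \<psi> G)"
  obtain A where A: "simple_graph A" "subgraph (with_proj A) (with_proj G)"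
    and ratio: "hall_ratio G = real (card (pverts A)) / real (independence_number A)"
    using hall_ratio_attained[OF assms(1)] .
  let ?B = "graph_join (image_graph \<phi> A) (image_graph \<psi> A)"
  have sub: "pverts A \<subseteq> pverts G" "parcs A \<subseteq> parcs G"
    using A(2) by (simp_all add: subgraph_with_proj_iff)
  have inj: "inj_on \<phi> (pverts A)" "inj_on \<psi> (pverts A)"
    using assms(2,3) sub(1) inj_on_subset by blast+
  have disj: "\<phi> ` pverts A \<inter> \<psi> ` pverts A = {}"
    using assms(4) sub(1) by blast
  have H: "simple_graph ?H"
    using assms by (intro simple_graph_join simple_graph_image) auto
  have B: "simple_graph ?B"
    using A inj disj by (intro simple_graph_join simple_graph_image) auto
  have "subgraph (with_proj ?B) (with_proj ?H)"
    unfolding subgraph_with_proj_iff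
    using simple_graph_wf[OF H] simple_graph_wf[OF B] sub by (auto simp: graph_join_def)
  then have ge: "real (card (pverts ?B)) / real (independence_number ?B) \<le> hall_ratio ?H"
    using hall_ratio_ge H B by blast
  have "finite (pverts A)"
    using A(1) by (simp add: simple_graph_def pair_graph_def pair_digraph_def
        pair_fin_digraph_def pair_fin_digraph_axioms_def)
  then have card_B: "card (pverts ?B) = 2 * card (pverts A)"
    using disj inj by (simp add: graph_join_def card_Un_disjoint card_image)
  obtain S where S: "independent_set ?B S" "card S = independence_number ?B"
    using independence_number_attained[OF B] .
  have "independent_set (image_graph \<phi> A) S \<or> independent_set (image_graph \<psi> A) S"
    using independent_set_join S(1) .
  then have "card S \<le> independence_number A"
    using card_le_independence_number simple_graph_image[OF A(1)]
      independence_number_image_le[OF A(1)] inj order.trans by metis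
  then have "2 * hall_ratio G \<le> real (card (pverts ?B)) / real (independence_number ?B)"
    using S(2) independence_number_pos[OF B]
    by (simp add: ratio card_B frac_le)
  then show ?thesis
    using ge by linarith
qed

section \<open>Flexibility of a single graph\<close>

text \<open>Longer lists are cut down to \<open>k\<close> colors while keeping the requested color,
  for which \<open>1 \<le> k\<close> makes room.\<close>

lemma flexible_mono:
  assumes "flexible G k \<epsilon>" "1 \<le> k" "k \<le> k'"
  shows "flexible G k' \<epsilon>"
  unfolding flexible_def
proof (intro allI impI)
  fix L :: "'a \<Rightarrow> nat set" and q
  assume L: "k_assignment G k' L" and q: "request G L q"
  have "\<exists>B. (if v \<in> dom q then {the (q v)} else {}) \<subseteq> B \<and> B \<subseteq> L v \<and> card B = k"
    if "v \<in> pverts G" for v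
    using that L q assms(2,3)
    by (intro exists_subset_between) (auto simp: k_assignment_def request_def)
  then obtain M where M: "\<And>v. v \<in> pverts G \<Longrightarrow>
      (if v \<in> dom q then {the (q v)} else {}) \<subseteq> M v \<and> M v \<subseteq> L v \<and> card (M v) = k"
    by metis
  have "k_assignment G k M"
    using M L unfolding k_assignment_def by (meson finite_subset)
  moreover have "the (q v) \<in> M v" if "v \<in> dom q" for v
  proof -
    have "v \<in> pverts G"
      using q that unfolding request_def by blast
    then show ?thesis
      using M[of v] that by simp
  qed
  then have "request G M q"
    using q by (simp add: request_def)
  ultimately obtain f where "proper_list_coloring G M f"
    "\<epsilon> * card (dom q) \<le> card {v \<in> dom q. q v = Some (f v)}"
    using assms(1) by (auto simp: flexible_def satisfiable_def)
  moreover from this have "proper_list_coloring G L f"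
    using M unfolding proper_list_coloring_def by blast
  ultimately show "satisfiable G L q \<epsilon>"
    by (auto simp: satisfiable_def)
qed

text \<open>Greedy choice: fewer than \<open>card V\<close> colors have been used when a vertex is
  reached, so its list still contains a fresh one.\<close>

lemma exists_injective_choice:
  assumes "finite V" "\<And>v. v \<in> V \<Longrightarrow> finite (M v) \<and> card V \<le> card (M v)"
  shows "\<exists>f. inj_on f V \<and> (\<forall>v\<in>V. f v \<in> M v)"
  using assms
proof (induction V)
  case (insert v V)
  then have "\<exists>f. inj_on f V \<and> (\<forall>v\<in>V. f v \<in> M v)"
    by (metis card_insert_le insertCI order.trans)
  then obtain f where f: "inj_on f V" "\<forall>v\<in>V. f v \<in> M v"
    by blast
  have "card (f ` V) < card (M v)"
    using insert card_image_le[of V f] by fastforce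
  then obtain c where c: "c \<in> M v" "c \<notin> f ` V"
    using insert.hyps card_mono[of "f ` V" "M v"] by force
  let ?g = "f(v := c)"
  have "inj_on ?g (insert v V)"
    using insert.hyps f(1) c(2) by (auto simp: inj_on_def)
  moreover have "\<forall>u\<in>insert v V. ?g u \<in> M u"
    using insert.hyps f(2) c(1) by auto
  ultimately show ?case
    by blast
qed simp

text \<open>Grant the request on a maximum independent set \<open>I\<close> of the subgraph induced
  by \<open>dom q\<close>; the Hall ratio makes \<open>I\<close> large enough. The other vertices
  receive pairwise distinct colors that avoid those granted on \<open>I\<close>.\<close>

lemma flexible_card:
  assumes "simple_graph G"
  shows "flexible G (card (pverts G)) (1 / hall_ratio G)"
  unfolding flexible_def
proof (intro allI impI)
  fix L :: "'a \<Rightarrow> nat set" and q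
  assume L: "k_assignment G (card (pverts G)) L" and q: "request G L q"
  interpret pair_graph G
    using assms by (simp add: simple_graph_def)
  define A where "A = \<lparr> pverts = dom q, parcs = parcs G \<inter> dom q \<times> dom q \<rparr>"
  have dom: "dom q \<noteq> {}" "dom q \<subseteq> pverts G" "\<And>v. v \<in> dom q \<Longrightarrow> the (q v) \<in> L v"
    using q by (auto simp: request_def)
  have "sym (parcs A)"
    using arcs_symmetric by (auto simp: A_def sym_def)
  then have "pair_graph A"
    using no_loops' finite_subset[OF dom(2) pair_finite_verts] pair_finite_arcs
    by unfold_locales (auto simp: A_def symmetric_def)
  then have A: "simple_graph A"
    using dom(1) by (simp add: simple_graph_def A_def)
  have "subgraph (with_proj A) (with_proj G)"
    unfolding subgraph_with_proj_iff
    using simple_graph_wf[OF A] simple_graph_wf[OF assms] dom(2) by (auto simp: A_def)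
  then have ratio: "real (card (dom q)) / real (independence_number A) \<le> hall_ratio G"
    using hall_ratio_ge[OF assms A] by (simp add: A_def)
  obtain I where I: "independent_set A I" "card I = independence_number A"
    using independence_number_attained[OF A] .
  have I_sub: "I \<subseteq> dom q"
    using I(1) by (simp add: independent_set_def A_def)
  have I_indep: "(u, v) \<notin> parcs G" if "u \<in> I" "v \<in> I" for u v
    using that I(1) I_sub by (simp add: independent_set_def A_def) blast
  have fin_I: "finite I"
    using I_sub dom(2) pair_finite_verts finite_subset by metis
  define Q where "Q = (\<lambda>v. the (q v)) ` I"
  \<comment> \<open>Removing at most \<open>card I\<close> colors from a list as large as the vertex
    set leaves one color for each vertex outside \<open>I\<close>.\<close>
  have "finite (L v - Q) \<and> card (pverts G - I) \<le> card (L v - Q)" if "v \<in> pverts G - I" for v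
  proof -
    have Lv: "finite (L v)" "card (L v) = card (pverts G)"
      using L that by (auto simp: k_assignment_def)
    have "card (L v) - card Q \<le> card (L v - Q)"
      using fin_I by (intro diff_card_le_card_Diff) (simp add: Q_def)
    moreover have "card Q \<le> card I"
      using fin_I by (simp add: Q_def card_image_le)
    moreover have "card (pverts G - I) = card (pverts G) - card I"
      using fin_I I_sub dom(2) by (intro card_Diff_subset) auto
    ultimately show ?thesis
      using Lv by simp
  qed
  then obtain g where g: "inj_on g (pverts G - I)" "\<forall>v\<in>pverts G - I. g v \<in> L v - Q"
    using exists_injective_choice[of "pverts G - I" "\<lambda>v. L v - Q"] pair_finite_verts by auto
  define f where "f v = (if v \<in> I then the (q v) else g v)" for v
  have "f v \<in> L v" if "v \<in> pverts G" for v
    using that dom(3)[of v] subsetD[OF I_sub, of v] g(2) by (auto simp: f_def)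
  moreover have "f u \<noteq> f v" if "(u, v) \<in> parcs G" for u v
  proof -
    have uv: "u \<in> pverts G" "v \<in> pverts G" "u \<noteq> v"
      using that wellformed' no_loops' by blast+
    consider "u \<in> I" "v \<notin> I" | "u \<notin> I" "v \<in> I" | "u \<notin> I" "v \<notin> I"
      using I_indep[of u v] \<open>(u, v) \<in> parcs G\<close> by blast
    then show ?thesis
    proof cases
      case 1
      then have "f u \<in> Q" "f v \<notin> Q"
        using g(2) uv by (auto simp: f_def Q_def)
      then show ?thesis by metis
    next
      case 2
      then have "f u \<notin> Q" "f v \<in> Q"
        using g(2) uv by (auto simp: f_def Q_def)
      then show ?thesis by metis
    next
      case 3
      then show ?thesis
        using g(1) uv by (auto simp: f_def inj_on_def)
    qed
  qed
  ultimately have "proper_list_coloring G L f"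
    by (auto simp: proper_list_coloring_def)
  moreover have "1 / hall_ratio G * card (dom q) \<le> card {v \<in> dom q. q v = Some (f v)}"
  proof -
    have "I \<subseteq> {v \<in> dom q. q v = Some (f v)}"
      using I_sub by (auto simp: f_def)
    moreover have "finite {v \<in> dom q. q v = Some (f v)}"
      using finite_subset[OF dom(2) pair_finite_verts] by simp
    ultimately have "card I \<le> card {v \<in> dom q. q v = Some (f v)}"
      by (simp add: card_mono)
    moreover have "1 / hall_ratio G * card (dom q) \<le> card I"
      using ratio hall_ratio_ge_one[OF assms] independence_number_pos[OF A]
      by (simp add: I(2) field_simps)
    ultimately show ?thesis
      by linarith
  qed
  ultimately show "satisfiable G L q (1 / hall_ratio G)"
    by (auto simp: satisfiable_def)
qed

text \<open>The order of \<open>G\<close> is an admissible list size, positive because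
  \<open>G\<close> is nonempty, so the least such size exists and has the defining property.\<close>

lemma chi_flex_flexible:
  assumes "simple_graph G"
  shows "1 \<le> chi_flex G" "flexible G (chi_flex G) (1 / hall_ratio G)"
proof -
  interpret pair_graph G
    using assms by (simp add: simple_graph_def)
  have "0 < card (pverts G)"
    using assms pair_finite_verts by (simp add: simple_graph_def card_gt_0_iff)
  then have "\<exists>k. 1 \<le> k \<and> flexible G k (1 / hall_ratio G)"
    using flexible_card[OF assms] by (intro exI[of _ "card (pverts G)"]) auto
  then have "1 \<le> chi_flex G \<and> flexible G (chi_flex G) (1 / hall_ratio G)"
    unfolding chi_flex_def by (rule LeastI_ex)
  then show "1 \<le> chi_flex G" "flexible G (chi_flex G) (1 / hall_ratio G)"
    by auto
qed

section \<open>Coloring the join\<close>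

text \<open>The set \<open>S\<close> holds the vertices that are already colored. Instead of passing
  to the subgraph without \<open>S\<close>, all of \<open>G\<close> is colored with arbitrary lists
  on \<open>S\<close>, and the colors obtained there are to be discarded.\<close>

lemma choosable_superset:
  fixes M :: "'a \<Rightarrow> nat set"
  assumes "choosable G s" "\<And>v. v \<in> pverts G - S \<Longrightarrow> s \<le> card (M v)"
  obtains f where "\<And>v. v \<in> pverts G - S \<Longrightarrow> f v \<in> M v"
    "\<And>u v. (u, v) \<in> parcs G \<Longrightarrow> f u \<noteq> f v"
proof -
  have "\<exists>B. finite B \<and> card B = s \<and> (v \<in> pverts G - S \<longrightarrow> B \<subseteq> M v)" for v
  proof (cases "v \<in> pverts G - S")
    case True
    then show ?thesis
      using assms(2) obtain_subset_with_card_n by metis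
  next
    case False
    then show ?thesis
      by (intro exI[of _ "{..<s}"]) auto
  qed
  then obtain B where B: "\<And>v. finite (B v) \<and> card (B v) = s \<and> (v \<in> pverts G - S \<longrightarrow> B v \<subseteq> M v)"
    by metis
  then have "k_assignment G s B"
    by (simp add: k_assignment_def)
  then obtain f where "proper_list_coloring G B f"
    using assms(1) by (auto simp: choosable_def)
  then show ?thesis
    using that[of f] B by (fastforce simp: proper_list_coloring_def)
qed

text \<open>
  Exactly \<^term>\<open>l\<close> vertices are precolored, even if fewer suffice for the request, so
  that the remaining \<^term>\<open>2 * n - l\<close> vertices all keep \<^term>\<open>k - l\<close> colors.
\<close>

lemma join_coloring_satisfying_part:
  fixes L :: "'a \<Rightarrow> nat set"
  assumes G1: "simple_graph G1" "card (pverts G1) = n" "choosable G1 s" "flexible G1 k \<epsilon>"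
    and G2: "simple_graph G2" "card (pverts G2) = n" "choosable G2 s"
    and disj: "pverts G1 \<inter> pverts G2 = {}"
    and l: "0 \<le> \<epsilon>" "\<epsilon> * real n \<le> real l" "l \<le> n" "0 < k" "l \<le> k"
    and bound: "(2 * n - l) * (\<Sum>i<s. (k - l) choose i) < 2 ^ (k - l)"
    and L: "k_assignment (graph_join G1 G2) k L"
    and q: "request (graph_join G1 G2) L q"
  obtains f where "proper_list_coloring (graph_join G1 G2) L f"
    "\<epsilon> * real (card (dom q \<inter> pverts G1)) \<le> real (card {v \<in> dom q. q v = Some (f v)})"
proof -
  interpret G1: pair_graph G1
    using G1 by (simp add: simple_graph_def)
  interpret G2: pair_graph G2
    using G2 by (simp add: simple_graph_def)
  define D where "D = dom q \<inter> pverts G1"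
  have fin_D: "finite D"
    using G1.pair_finite_verts by (simp add: D_def)
  have L1: "k_assignment G1 k L"
    using L by (simp add: k_assignment_def graph_join_def)
  have Lfin: "finite (L v) \<and> card (L v) = k" if "v \<in> pverts G1 \<union> pverts G2" for v
    using L that by (simp add: k_assignment_def graph_join_def)
  have "finite (dom q)"
    using q G1.pair_finite_verts G2.pair_finite_verts
    by (intro finite_subset[of "dom q" "pverts G1 \<union> pverts G2"])
      (simp_all add: request_def graph_join_def)
  obtain g where g: "proper_list_coloring G1 L g"
    and sat: "\<epsilon> * real (card D) \<le> real (card {v \<in> D. q v = Some (g v)})"
  \<comment> \<open>Flexibility only speaks about requests with nonempty domain. If
    \<open>G1\<close> receives none, a coloring is extracted from an arbitrary request at a single
    vertex.\<close>
  proof (cases "D = {}")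
    case True
    obtain v where v: "v \<in> pverts G1"
      using G1(1) by (auto simp: simple_graph_def)
    obtain c where "c \<in> L v"
      using Lfin[of v] v l(4) by (metis UnI1 card_gt_0_iff ex_in_conv)
    then have "request G1 L [v \<mapsto> c]"
      using v by (simp add: request_def)
    then obtain g where "proper_list_coloring G1 L g"
      using G1(4) L1 by (auto simp: flexible_def satisfiable_def)
    then show ?thesis
      using that True by simp
  next
    case False
    have dom: "dom (q |` pverts G1) = D"
      by (simp add: D_def)
    have "request G1 L (q |` pverts G1)"
      unfolding request_def dom using q False by (auto simp: request_def D_def)
    then have "satisfiable G1 L (q |` pverts G1) \<epsilon>"
      using G1(4) L1 by (simp add: flexible_def)
    moreover have "{v \<in> D. (q |` pverts G1) v = Some (g v)} = {v \<in> D. q v = Some (g v)}" for g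
      by (auto simp: D_def)
    ultimately show ?thesis
      using that by (auto simp only: satisfiable_def dom)
  qed
  define T where "T = {v \<in> D. q v = Some (g v)}"
  have T_sub: "T \<subseteq> pverts G1"
    by (auto simp: T_def D_def)
  obtain S where S: "S \<subseteq> pverts G1" "card S = l"
    and sat_S: "\<epsilon> * real (card D) \<le> real (card (S \<inter> T))"
  \<comment> \<open>If the satisfied set \<open>T\<close> is small, it is enlarged to
    \<open>l\<close> vertices of \<open>G1\<close>. Otherwise any \<open>l\<close> of its vertices
    suffice, because \<open>l\<close> is at least \<open>\<epsilon> * n\<close> and \<open>D\<close>
    has at most \<open>n\<close> elements.\<close>
  proof (cases "card T \<le> l")
    case True
    then obtain S where "T \<subseteq> S" "S \<subseteq> pverts G1" "card S = l"
      using exists_subset_between[of T l "pverts G1"] T_sub G1(2) l(3) G1.pair_finite_verts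
      by blast
    moreover from this have "S \<inter> T = T"
      by blast
    ultimately show ?thesis
      using that sat by (simp add: T_def)
  next
    case False
    then obtain S where S: "S \<subseteq> T" "card S = l"
      using obtain_subset_with_card_n[of l T] by auto
    have "S \<inter> T = S" "S \<subseteq> pverts G1"
      using S(1) T_sub by blast+
    moreover have "card D \<le> n"
      using card_mono[OF G1.pair_finite_verts, of D] G1(2) by (simp add: D_def)
    then have "\<epsilon> * real (card D) \<le> \<epsilon> * real n"
      using l(1) by (intro mult_left_mono) auto
    ultimately show ?thesis
      using that[of S] S(2) l(2) by simp
  qed
  have fin_S: "finite S"
    using S(1) G1.pair_finite_verts finite_subset by blast
  define V where "V = pverts G1 - S"
  define W where "W = pverts G2"
  \<comment> \<open>At least \<open>k - l\<close> colors survive, perhaps more; the lists are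
    trimmed because the splitting lemma expects a common size.\<close>
  have "\<exists>B. B \<subseteq> L v - g ` S \<and> finite B \<and> card B = k - l" if "v \<in> V \<union> W" for v
  proof -
    have "card (L v) - card (g ` S) \<le> card (L v - g ` S)"
      using fin_S by (intro diff_card_le_card_Diff) simp
    moreover have "card (g ` S) \<le> l"
      using card_image_le[OF fin_S, of g] S(2) by simp
    moreover have "card (L v) = k"
      using Lfin[of v] that by (auto simp: V_def W_def)
    ultimately have "k - l \<le> card (L v - g ` S)"
      by linarith
    then show ?thesis
      using obtain_subset_with_card_n by metis
  qed
  then obtain M where M: "\<And>v. v \<in> V \<union> W \<Longrightarrow>
      M v \<subseteq> L v - g ` S \<and> finite (M v) \<and> card (M v) = k - l"
    by metis
  have "card V + card W = 2 * n - l"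
    using fin_S S G1(2) G2(2) l(3) by (simp add: V_def W_def card_Diff_subset)
  then have bound': "(card V + card W) * (\<Sum>i<s. (k - l) choose i) < 2 ^ (k - l)"
    using bound by simp
  have fin: "finite V" "finite W"
    using G1.pair_finite_verts G2.pair_finite_verts by (auto simp: V_def W_def)
  obtain A where A: "\<And>v. v \<in> V \<Longrightarrow> s \<le> card (M v \<inter> A)" "\<And>v. v \<in> W \<Longrightarrow> s \<le> card (M v - A)"
    using exists_color_split[OF fin _ bound', of M] M by blast
  obtain f1 where f1: "\<And>v. v \<in> V \<Longrightarrow> f1 v \<in> M v \<inter> A"
    and f1_proper: "\<And>u v. (u, v) \<in> parcs G1 \<Longrightarrow> f1 u \<noteq> f1 v"
    using choosable_superset[OF G1(3), of S "\<lambda>v. M v \<inter> A"] A(1) unfolding V_def by blast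
  obtain f2 where f2: "\<And>v. v \<in> W \<Longrightarrow> f2 v \<in> M v - A"
    and f2_proper: "\<And>u v. (u, v) \<in> parcs G2 \<Longrightarrow> f2 u \<noteq> f2 v"
    using choosable_superset[OF G2(3), of "{}" "\<lambda>v. M v - A"] A(2) unfolding W_def by auto
  define f where "f v = (if v \<in> S then g v else if v \<in> V then f1 v else f2 v)" for v
  have f_S: "f v \<in> g ` S" if "v \<in> S" for v
    using that by (simp add: f_def)
  have f_V: "f v = f1 v" "f v \<in> A" "f v \<notin> g ` S" "f v \<in> L v" if "v \<in> V" for v
    using that f1[OF that] M[of v] by (auto simp: f_def V_def)
  have f_W: "f v = f2 v" "f v \<notin> A" "f v \<notin> g ` S" "f v \<in> L v" if "v \<in> W" for v
  proof -
    have "v \<notin> S" "v \<notin> V"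
      using that disj S(1) by (auto simp: V_def W_def)
    then show eq: "f v = f2 v"
      by (simp add: f_def)
    show "f v \<notin> A" "f v \<notin> g ` S" "f v \<in> L v"
      using f2[OF that] M[of v] that by (auto simp: eq)
  qed
  have verts1: "pverts G1 = S \<union> V"
    using S(1) by (auto simp: V_def)
  have cross: "f u \<noteq> f v" if "u \<in> pverts G1" "v \<in> W" for u v
    using that f_S[of u] f_V(2)[of u] f_W(2,3)[of v] verts1 by (metis UnE)
  have in1: "f u \<noteq> f v" if "(u, v) \<in> parcs G1" for u v
  proof -
    have uv: "u \<in> S \<or> u \<in> V" "v \<in> S \<or> v \<in> V"
      using G1.wellformed'[OF that] verts1 by auto
    have "g u \<noteq> g v"
      using g that by (auto simp: proper_list_coloring_def)
    then have "f u \<noteq> f v" if "u \<in> S" "v \<in> S"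
      using that by (simp add: f_def)
    moreover have "f u \<noteq> f v" if "u \<in> V" "v \<in> V"
      using that f_V(1) f1_proper[OF \<open>(u, v) \<in> parcs G1\<close>] by simp
    ultimately show ?thesis
      using uv f_S f_V(3) by metis
  qed
  have in2: "f u \<noteq> f v" if "(u, v) \<in> parcs G2" for u v
    using f2_proper[OF that] G2.wellformed'[OF that] f_W(1) by (simp add: W_def)
  have "g v \<in> L v" if "v \<in> S" for v
    using g S(1) that by (auto simp: proper_list_coloring_def)
  then have "f v \<in> L v" if "v \<in> S" for v
    using that by (simp add: f_def)
  then have lists: "f v \<in> L v" if "v \<in> pverts G1 \<union> pverts G2" for v
    using that f_V(4) f_W(4) verts1 unfolding W_def by blast
  have "proper_list_coloring (graph_join G1 G2) L f"
    unfolding proper_list_coloring_def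
  proof (intro conjI ballI)
    fix v
    assume "v \<in> pverts (graph_join G1 G2)"
    then show "f v \<in> L v"
      using lists by (simp add: graph_join_def)
  next
    fix e
    assume e: "e \<in> parcs (graph_join G1 G2)"
    obtain u v where uv: "e = (u, v)"
      by (cases e)
    have "f u \<noteq> f v"
      using e in1[of u v] in2[of u v] cross[of u v] cross[of v u]
      unfolding uv by (auto simp: graph_join_def W_def)
    then show "case e of (u, v) \<Rightarrow> f u \<noteq> f v"
      by (simp add: uv)
  qed
  moreover have "S \<inter> T \<subseteq> {v \<in> dom q. q v = Some (f v)}"
    by (auto simp: T_def D_def f_def)
  then have "card (S \<inter> T) \<le> card {v \<in> dom q. q v = Some (f v)}"
    using \<open>finite (dom q)\<close> by (intro card_mono) auto
  then have "\<epsilon> * real (card (dom q \<inter> pverts G1)) \<le> real (card {v \<in> dom q. q v = Some (f v)})"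
    using sat_S by (simp add: D_def)
  ultimately show ?thesis
    using that by blast
qed

lemma graph_join_commute: "graph_join G1 G2 = graph_join G2 G1"
  by (auto simp: graph_join_def)

text \<open>
  It suffices to serve the requests in the copy that receives at least half of them, which
  costs a factor of two in the satisfied fraction.
\<close>

lemma flexible_join:
  assumes G1: "simple_graph G1" "card (pverts G1) = n" "choosable G1 s" "flexible G1 k \<epsilon>"
    and G2: "simple_graph G2" "card (pverts G2) = n" "choosable G2 s" "flexible G2 k \<epsilon>"
    and disj: "pverts G1 \<inter> pverts G2 = {}"
    and l: "0 \<le> \<epsilon>" "\<epsilon> * real n \<le> real l" "l \<le> n" "0 < k" "l \<le> k"
    and bound: "(2 * n - l) * (\<Sum>i<s. (k - l) choose i) < 2 ^ (k - l)"
  shows "flexible (graph_join G1 G2) k (\<epsilon> / 2)"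
  unfolding flexible_def
proof (intro allI impI)
  fix L :: "'a \<Rightarrow> nat set" and q
  assume L: "k_assignment (graph_join G1 G2) k L" and q: "request (graph_join G1 G2) L q"
  have dom: "dom q \<subseteq> pverts G1 \<union> pverts G2"
    using q by (simp add: request_def graph_join_def)
  have "dom q = (dom q \<inter> pverts G1) \<union> (dom q \<inter> pverts G2)"
    using dom by blast
  then have card_le: "card (dom q) \<le> card (dom q \<inter> pverts G1) + card (dom q \<inter> pverts G2)"
    using card_Un_le by metis
  have half: "\<epsilon> / 2 * real (card (dom q)) \<le> \<epsilon> * real c" if "card (dom q) \<le> 2 * c" for c
  proof -
    have "\<epsilon> * real (card (dom q)) \<le> \<epsilon> * real (2 * c)"
      using l(1) that by (intro mult_left_mono) (auto simp only: of_nat_le_iff)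
    then show ?thesis
      by simp
  qed
  show "satisfiable (graph_join G1 G2) L q (\<epsilon> / 2)"
  proof (cases "card (dom q) \<le> 2 * card (dom q \<inter> pverts G1)")
    case True
    obtain f where "proper_list_coloring (graph_join G1 G2) L f"
      "\<epsilon> * real (card (dom q \<inter> pverts G1)) \<le> real (card {v \<in> dom q. q v = Some (f v)})"
      using join_coloring_satisfying_part[OF G1 G2(1-3) disj l bound L q] .
    then show ?thesis
      using half[OF True] by (force simp: satisfiable_def)
  next
    case False
    then have le: "card (dom q) \<le> 2 * card (dom q \<inter> pverts G2)"
      using card_le by linarith
    have disj': "pverts G2 \<inter> pverts G1 = {}"
      using disj by blast
    obtain f where "proper_list_coloring (graph_join G1 G2) L f"
      "\<epsilon> * real (card (dom q \<inter> pverts G2)) \<le> real (card {v \<in> dom q. q v = Some (f v)})"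
      using join_coloring_satisfying_part[OF G2 G1(1-3) disj' l bound, of L q] L q
      unfolding graph_join_commute[of G2 G1] by blast
    then show ?thesis
      using half[OF le] by (force simp: satisfiable_def)
  qed
qed

section \<open>From flexibility of the join to its list flexibility number\<close>

lemma flexible_weaken:
  assumes "flexible G k \<epsilon>" "\<delta> \<le> \<epsilon>"
  shows "flexible G k \<delta>"
proof -
  have "\<delta> * real c \<le> \<epsilon> * real c" for c
    using assms(2) by (simp add: mult_right_mono)
  then show ?thesis
    using assms(1) unfolding flexible_def satisfiable_def by (meson order.trans)
qed

theorem theorem7:
  fixes G :: "'a pair_pre_digraph" and G1 G2 H :: "'b pair_pre_digraph"
    and n s m :: nat and l :: int and r :: real
  assumes "simple_graph G" and "card (pverts G) = n" and "n \<ge> 2"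
    and "choosable G s" and "chi_flex G = m"
    and "l = \<lceil>real n / hall_ratio G\<rceil>"
    and "simple_graph G1" and "simple_graph G2"
    and "pverts G1 \<inter> pverts G2 = {}"
    and "graph_iso G G1" and "graph_iso G G2"
    and "H = graph_join G1 G2"
    and "r > 2"
  shows "int (chi_flex H) \<le>
    Max {\<lceil>real_of_int l + log 2 (2 * real n - real_of_int l) / (1 - binary_entropy (1 / r))\<rceil>,
         \<lceil>r * (real s - 1) + real_of_int l\<rceil>,
         int m}"
proof -
  define k where "k = nat (Max {\<lceil>real_of_int l + log 2 (2 * real n - real_of_int l) / (1 - binary_entropy (1 / r))\<rceil>,
         \<lceil>r * (real s - 1) + real_of_int l\<rceil>, int m})" (is "_ = nat ?K")
  define \<epsilon> where "\<epsilon> = 1 / hall_ratio G"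
  have ratio: "1 \<le> hall_ratio G"
    using hall_ratio_ge_one assms(1) .
  have chi: "1 \<le> m" "flexible G m \<epsilon>"
    using chi_flex_flexible[OF assms(1)] assms(5) by (auto simp: \<epsilon>_def)
  have K: "\<lceil>real_of_int l + log 2 (2 * real n - real_of_int l) / (1 - binary_entropy (1 / r))\<rceil> \<le> ?K"
    "\<lceil>r * (real s - 1) + real_of_int l\<rceil> \<le> ?K" "int m \<le> ?K"
    by (auto intro: Max_ge)
  \<comment> \<open>The entry \<open>int m\<close> keeps the maximum nonnegative, so converting it
    to a natural number loses nothing.\<close>
  have k: "int k = ?K" "m \<le> k"
    using K(3) by (auto simp: k_def)
  have kl: "real_of_int l + log 2 (2 * real n - real_of_int l) / (1 - binary_entropy (1 / r)) \<le> real k"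
    "r * (real s - 1) + real_of_int l \<le> real k"
    using K(1,2) unfolding k(1)[symmetric] ceiling_le_iff by simp_all
  define l' where "l' = nat l"
  have "0 \<le> real n / hall_ratio G"
    using ratio by simp
  then have l': "l = int l'"
    unfolding l'_def assms(6) by linarith
  \<comment> \<open>Since the Hall ratio is at least 1, \<open>l' \<le> n\<close>, and the natural
    number subtraction \<open>2 * n - l'\<close> is exact.\<close>
  have "real n / hall_ratio G \<le> real n"
    using ratio mult_right_mono[of 1 "hall_ratio G" "real n"] by (simp add: field_simps)
  then have l'_le: "l' \<le> n"
    using l' assms(6) ceiling_le_iff[of "real n / hall_ratio G" "int n"] by simp
  have l'_ge: "\<epsilon> * real n \<le> real l'"
    using l' assms(6) le_of_int_ceiling[of "real n / hall_ratio G"] by (simp add: \<epsilon>_def)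
  have diff: "2 * real n - real_of_int l = real (2 * n - l')"
    using l' l'_le by simp
  \<comment> \<open>Here \<open>n \<ge> 2\<close> enters: \<open>2 * n - l'\<close> is at least
    \<open>n\<close>, so its logarithm is positive, which also yields \<open>l' \<le> k\<close>
    below.\<close>
  have gt: "1 < real (2 * n - l')"
    using l'_le assms(3) by linarith
  have "binary_entropy (1 / r) < 1"
    using assms(13) by (intro binary_entropy_less_one) (auto simp: field_simps)
  then have "0 \<le> log 2 (real (2 * n - l')) / (1 - binary_entropy (1 / r))"
    using gt by simp
  then have "l' \<le> k"
    using kl(1) l' unfolding diff by simp
  \<comment> \<open>After subtracting \<open>l'\<close>, the first two entries of the maximum are
    exactly the two lower bounds that the entropy estimate requires of
    \<open>N = k - l'\<close>.\<close>
  have "real (2 * n - l') * (\<Sum>i<s. real ((k - l') choose i)) < 2 ^ (k - l')"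
    using assms(13) gt kl \<open>l' \<le> k\<close> unfolding diff l'
    by (intro union_bound_entropy[of r]) (auto simp: of_nat_diff)
  then have "real ((2 * n - l') * (\<Sum>i<s. (k - l') choose i)) < real (2 ^ (k - l'))"
    unfolding of_nat_mult of_nat_sum of_nat_power by simp
  then have bound: "(2 * n - l') * (\<Sum>i<s. (k - l') choose i) < 2 ^ (k - l')"
    unfolding of_nat_less_iff .
  obtain \<phi> where \<phi>: "inj_on \<phi> (pverts G)" "G1 = image_graph \<phi> G"
    using graph_isoE[OF assms(10)] .
  obtain \<psi> where \<psi>: "inj_on \<psi> (pverts G)" "G2 = image_graph \<psi> G"
    using graph_isoE[OF assms(11)] .
  have "flexible G k \<epsilon>"
    using flexible_mono[OF chi(2,1) k(2)] .
  then have "flexible G1 k \<epsilon>" "flexible G2 k \<epsilon>"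
    using assms(1) \<phi> \<psi> by (auto intro: flexible_image)
  moreover have "choosable G1 s" "choosable G2 s"
    using assms(1,4) \<phi> \<psi> by (auto intro: choosable_image)
  moreover have "card (pverts G1) = n" "card (pverts G2) = n"
    using assms(2) \<phi> \<psi> by (auto simp: card_image)
  moreover have "0 \<le> \<epsilon>"
    using ratio by (simp add: \<epsilon>_def)
  ultimately have "flexible H k (\<epsilon> / 2)"
    unfolding assms(12) using assms(7-9) l'_ge l'_le chi(1) k(2) \<open>l' \<le> k\<close> bound
    by (intro flexible_join) auto
  moreover have "2 * hall_ratio G \<le> hall_ratio H"
    unfolding assms(12) \<phi>(2) \<psi>(2)
    using assms(1,9) \<phi> \<psi> by (intro hall_ratio_join_ge) auto
  \<comment> \<open>The doubled Hall ratio absorbs the factor of two lost by serving only one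
    copy.\<close>
  then have "1 / hall_ratio H \<le> \<epsilon> / 2"
    using ratio frac_le[of 1 1 "2 * hall_ratio G" "hall_ratio H"] by (simp add: \<epsilon>_def)
  ultimately have "flexible H k (1 / hall_ratio H)"
    by (rule flexible_weaken)
  then have "chi_flex H \<le> k"
    unfolding chi_flex_def using chi(1) k(2) by (intro Least_le) auto
  then show ?thesis
    unfolding k(1)[symmetric] by simp
qed

end
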